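(* Let $m,n\ge1$, $\omega\in(0,1]$, $p=\lceil\omega n\rceil$ and $A\in\mathbb{R}^{m\times n}$. Let $Q,R\subseteq N$ be such that $Q\cap R=\emptyset$. Suppose $x=[x_1\ \cdots\ x_n]^\top$ is a fully active solution of the normalized linear equation $A\otimes_\omega x=\mathbf{0}$, and let $C$ be the matrix defined by $C(i,j)=A(i,j)+x_j$. Then $x$ admits $(Q,R)$-relaxation if and only if the following two conditions hold for all $i\in M$: (i) $|Q_i|\le p-1-q_i$, (ii) $|R_i|\le n-p-r_i$.
   Context: Let $M=\{1,\ldots,m\}$, $N=\{1,\ldots,n\}$. For $\omega\in(0,1]$, $A\in\mathbb{R}^{m\times n}$ and $x\in\mathbb{R}^n$, $A\otimes_\omega x\in\mathbb{R}^m$ is the vector whose $i$-th entry is the $\lceil\omega n\rceil$-th smallest element (counted with multiplicity) of the multiset $\{A(i,j)+x_j : j\in N\}$. A solution $x\in\mathbb{R}^n$ of $A\otimes_\omega x=\mathbf{0}$ is fully active if for every $j\in N$ there is $i\in M$ with $A(i,j)+x_j=0$. For disjoint $Q,R\subseteq N$, a fully active solution $x$ admits $(Q,R)$-relaxation if there exists $\epsilon>0$ such that every $\hat x\in\mathbb{R}^n$ with $x_j-\epsilon\le\hat x_j<x_j$ for $j\in Q$, $x_k<\hat x_k\le x_k+\epsilon$ for $k\in R$, and $\hat x_l=x_l$ for $l\in N\setminus(Q\cup R)$ satisfies $A\otimes_\omega\hat x=\mathbf{0}$. For $i\in M$: $S_i=\{j\in N : C(i,j)=0\}$, $Q_i=Q\cap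 S_i$, $R_i=R\cap S_i$; $q_i$ is the number of negative elements and $r_i$ the number of positive elements in the $i$-th row of $C$. *)

theory Defs
  imports "HOL-Analysis.Analysis" "HOL-Library.Multiset"
begin

text \<open>
  The row index set \<open>M\<close> and the column index set \<open>N\<close> are the (finite, nonempty) types
  \<open>'m\<close> and \<open>'n\<close>, so \<open>m = CARD('m)\<close>, \<open>n = CARD('n)\<close> and \<open>N = UNIV\<close>.
\<close>

text \<open>Counted from 1 and with multiplicity; meaningful for \<open>1 \<le> k \<le> size X\<close>.\<close>
definition kth_smallest :: "nat \<Rightarrow> real multiset \<Rightarrow> real" where
  "kth_smallest k X = sorted_list_of_multiset X ! (k - 1)"

text \<open>For \<open>\<omega> \<in> (0,1]\<close> the rank \<open>\<lceil>\<omega> n\<rceil>\<close> lies in \<open>{1..n}\<close>, so \<open>nat\<close> truncates nothing.\<close>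
definition omega_mult :: "real \<Rightarrow> real^'n^'m \<Rightarrow> real^'n \<Rightarrow> real^'m" where
  "omega_mult \<omega> A x =
     (\<chi> i. kth_smallest (nat \<lceil>\<omega> * real CARD('n)\<rceil>) {# A $ i $ j + x $ j. j \<in># mset_set UNIV #})"

definition fully_active_solution :: "real \<Rightarrow> real^'n^'m \<Rightarrow> real^'n \<Rightarrow> bool" where
  "fully_active_solution \<omega> A x \<longleftrightarrow>
     omega_mult \<omega> A x = 0 \<and> (\<forall>j. \<exists>i. A $ i $ j + x $ j = 0)"

text \<open>Intended for disjoint \<open>Q\<close>, \<open>R\<close> and a fully active solution \<open>x\<close>.\<close>
definition admits_relaxation ::
  "real \<Rightarrow> real^'n^'m \<Rightarrow> 'n set \<Rightarrow> 'n set \<Rightarrow> real^'n \<Rightarrow> bool" where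
  "admits_relaxation \<omega> A Q R x \<longleftrightarrow>
     (\<exists>\<epsilon>>0. \<forall>y :: real^'n.
        (\<forall>j\<in>Q. x $ j - \<epsilon> \<le> y $ j \<and> y $ j < x $ j) \<and>
        (\<forall>k\<in>R. x $ k < y $ k \<and> y $ k \<le> x $ k + \<epsilon>) \<and>
        (\<forall>l\<in>UNIV - (Q \<union> R). y $ l = x $ l)
        \<longrightarrow> omega_mult \<omega> A y = 0)"

definition zero_cols :: "real^'n^'m \<Rightarrow> 'm \<Rightarrow> 'n set" where
  "zero_cols C i = {j. C $ i $ j = 0}"

definition num_neg :: "real^'n^'m \<Rightarrow> 'm \<Rightarrow> nat" where
  "num_neg C i = card {j. C $ i $ j < 0}"

definition num_pos :: "real^'n^'m \<Rightarrow> 'm \<Rightarrow> nat" where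
  "num_pos C i = card {j. C $ i $ j > 0}"

end

theory Submission
  imports Defs
begin

text \<open>
  The \<open>k\<close>-th smallest of \<open>n\<close> numbers is \<open>0\<close> iff fewer than \<open>k\<close> of them are negative and at most
  \<open>n - k\<close> of them are positive (\<open>kth_smallest_eq_iff\<close>).  Hence \<open>omega_mult \<omega> A y = 0\<close> depends only
  on how many entries of each row of \<open>A $ i $ j + y $ j\<close> are negative and how many are positive.

  Perturb \<open>x\<close> by less than the smallest absolute value of a nonzero entry of \<open>C\<close>.  Then nonzero
  entries keep their sign, while a zero entry in column \<open>j\<close> turns negative if \<open>j \<in> Q\<close>, positive if
  \<open>j \<in> R\<close>, and stays zero otherwise.  So in row \<open>i\<close> the perturbation has exactly
  \<open>q\<^sub>i + |Q\<^sub>i|\<close> negative and \<open>r\<^sub>i + |R\<^sub>i|\<close> positive entries, whatever the individual step sizes are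
  (\<open>card_neg_perturb\<close>, \<open>card_pos_perturb\<close>).  Conditions (i) and (ii) are thus equivalent to each
  single small perturbation being a solution.  If they hold, the sign gap serves as \<open>\<epsilon>\<close>;
  conversely, they follow from one perturbation that is small both for the given \<open>\<epsilon>\<close> and for the
  sign gap.
\<close>

text \<open>In a sorted list the elements satisfying a downward closed predicate form a prefix, whose
  length is the number of such elements.\<close>
lemma less_length_filter_sorted_iff:
  fixes xs :: "'a :: linorder list"
  assumes "sorted xs" and down: "\<And>a b. a \<le> b \<Longrightarrow> P b \<Longrightarrow> P a"
  shows "k < length (filter P xs) \<longleftrightarrow> k < length xs \<and> P (xs ! k)"
  using assms(1)
proof (induction xs arbitrary: k)
  case (Cons a xs)
  show ?case
  proof (cases "P a")
    case True
    then show ?thesis using Cons by (cases k) auto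
  next
    case False
    then have "\<not> P b" if "b \<in> set (a # xs)" for b
      using that Cons.prems down by auto
    then have "filter P (a # xs) = []" and "k < length (a # xs) \<Longrightarrow> \<not> P ((a # xs) ! k)"
      by (auto simp only: filter_empty_conv nth_mem)
    then show ?thesis by auto
  qed
qed simp

lemma kth_smallest_eq_iff:
  assumes "1 \<le> k" and "k \<le> size X"
  shows "kth_smallest k X = c \<longleftrightarrow>
    size {#a \<in># X. a < c#} < k \<and> k + size {#a \<in># X. c < a#} \<le> size X"
proof -
  let ?xs = "sorted_list_of_multiset X"
  have len: "length (filter P ?xs) = size (filter_mset P X)" for P
    by (metis mset_filter mset_sorted_list_of_multiset size_mset)
  have k: "k - 1 < length ?xs"
    using assms len[of "\<lambda>_. True"] by simp
  have less: "k - 1 < size {#a \<in># X. a < c#} \<longleftrightarrow> kth_smallest k X < c"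
    using less_length_filter_sorted_iff[of ?xs "\<lambda>a. a < c" "k - 1"] k
    by (simp add: len kth_smallest_def)
  have le: "k - 1 < size {#a \<in># X. a \<le> c#} \<longleftrightarrow> kth_smallest k X \<le> c"
    using less_length_filter_sorted_iff[of ?xs "\<lambda>a. a \<le> c" "k - 1"] k
    by (simp add: len kth_smallest_def)
  have "size X = size {#a \<in># X. a \<le> c#} + size {#a \<in># X. \<not> a \<le> c#}"
    by (metis multiset_partition size_union)
  then have "size X = size {#a \<in># X. a \<le> c#} + size {#a \<in># X. c < a#}"
    by (simp add: not_le)
  then show ?thesis
    using less le assms(1) by linarith
qed

lemma size_filter_image_mset_UNIV:
  fixes f :: "'n::finite \<Rightarrow> real"
  shows "size (filter_mset P {#f j. j \<in># mset_set UNIV#}) = card {j. P (f j)}"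
  by (simp add: filter_mset_image_mset)

lemma omega_mult_eq_0_iff:
  fixes A :: "real^'n^'m"
  assumes "0 < \<omega>" and "\<omega> \<le> 1" and p: "p = nat \<lceil>\<omega> * real CARD('n)\<rceil>"
  shows "omega_mult \<omega> A y = 0 \<longleftrightarrow>
    (\<forall>i. card {j. A $ i $ j + y $ j < 0} < p \<and>
         p + card {j. 0 < A $ i $ j + y $ j} \<le> CARD('n))"
proof -
  have "0 < \<omega> * real CARD('n)"
    using assms(1) by simp
  then have p1: "1 \<le> p"
    unfolding p by linarith
  have "\<omega> * real CARD('n) \<le> real CARD('n)"
    using assms(2) by (simp add: mult_left_le_one_le assms(1) less_imp_le)
  then have pn: "p \<le> CARD('n)"
    unfolding p by linarith
  have "kth_smallest p {#A $ i $ j + y $ j. j \<in># mset_set UNIV#} = 0 \<longleftrightarrow>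
      card {j. A $ i $ j + y $ j < 0} < p \<and>
      p + card {j. 0 < A $ i $ j + y $ j} \<le> CARD('n)" for i
    using kth_smallest_eq_iff[OF p1, of "{#A $ i $ j + y $ j. j \<in># mset_set UNIV#}" 0] pn
    by (simp add: size_filter_image_mset_UNIV)
  then show ?thesis
    by (simp add: omega_mult_def vec_eq_iff flip: p)
qed

lemma nonzero_entries_bounded_away:
  fixes C :: "real^'n^'m"
  obtains \<delta> where "0 < \<delta>" and "\<And>i j. C $ i $ j \<noteq> 0 \<Longrightarrow> \<delta> < \<bar>C $ i $ j\<bar>"
proof -
  define S where "S = insert 1 ((\<lambda>(i, j). \<bar>C $ i $ j\<bar>) ` {(i, j). C $ i $ j \<noteq> 0})"
  have fin: "finite S" by (simp add: S_def)
  have pos: "0 < Min S"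
    using fin by (subst Min_gr_iff) (auto simp: S_def)
  have "Min S \<le> \<bar>C $ i $ j\<bar>" if "C $ i $ j \<noteq> 0" for i j
    by (rule Min_le[OF fin]) (use that in \<open>auto simp: S_def\<close>)
  then show thesis
    using pos by (intro that[of "Min S / 2"]) fastforce+
qed

text \<open>The hypotheses on \<open>d\<close> are those that a small relaxation step \<open>y - x\<close> satisfies relative to a
  row \<open>c\<close> of \<open>C\<close>; the bound by \<open>\<bar>c j\<bar>\<close> prevents nonzero entries from changing sign.\<close>
lemma card_neg_perturb:
  fixes c d :: "'n::finite \<Rightarrow> real"
  assumes small: "\<And>j. c j \<noteq> 0 \<Longrightarrow> \<bar>d j\<bar> < \<bar>c j\<bar>"
    and neg: "\<And>j. d j < 0 \<longleftrightarrow> j \<in> Q"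
  shows "card {j. c j + d j < 0} = card {j. c j < 0} + card (Q \<inter> {j. c j = 0})"
proof -
  have "c j + d j < 0 \<longleftrightarrow> c j < 0 \<or> j \<in> Q \<and> c j = 0" for j
    using small[of j] neg[of j] by (cases "c j = 0") auto
  then have "{j. c j + d j < 0} = {j. c j < 0} \<union> (Q \<inter> {j. c j = 0})"
    by auto
  then show ?thesis
    by (simp add: card_Un_disjoint disjoint_iff)
qed

lemma card_pos_perturb:
  fixes c d :: "'n::finite \<Rightarrow> real"
  assumes "\<And>j. c j \<noteq> 0 \<Longrightarrow> \<bar>d j\<bar> < \<bar>c j\<bar>"
    and "\<And>j. 0 < d j \<longleftrightarrow> j \<in> R"
  shows "card {j. 0 < c j + d j} = card {j. 0 < c j} + card (R \<inter> {j. c j = 0})"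
proof -
  have "- c j + - d j < 0 \<longleftrightarrow> 0 < c j + d j" for j
    by linarith
  then show ?thesis
    using card_neg_perturb[of "\<lambda>j. - c j" "\<lambda>j. - d j" R] assms by simp
qed

theorem proposition5p1:
  fixes A C :: "real^'n^'m" and x :: "real^'n" and \<omega> :: real and p :: nat
    and Q R :: "'n set"
  assumes "0 < \<omega>" and "\<omega> \<le> 1"
    and "p = nat \<lceil>\<omega> * real CARD('n)\<rceil>"
    and "Q \<inter> R = {}"
    and "fully_active_solution \<omega> A x"
    and "C = (\<chi> i j. A $ i $ j + x $ j)"
  shows "admits_relaxation \<omega> A Q R x \<longleftrightarrow>
    (\<forall>i. int (card (Q \<inter> zero_cols C i)) \<le> int p - 1 - int (num_neg C i) \<and>
         int (card (R \<inter> zero_cols C i)) \<le> int CARD('n) - int p - int (num_pos C i))"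
    (is "_ \<longleftrightarrow> ?cond")
proof -
  define relaxed where "relaxed \<epsilon> y \<longleftrightarrow>
      (\<forall>j\<in>Q. x $ j - \<epsilon> \<le> y $ j \<and> y $ j < x $ j) \<and>
      (\<forall>k\<in>R. x $ k < y $ k \<and> y $ k \<le> x $ k + \<epsilon>) \<and>
      (\<forall>l\<in>UNIV - (Q \<union> R). y $ l = x $ l)" for \<epsilon> and y :: "real^'n"
  have admits: "admits_relaxation \<omega> A Q R x \<longleftrightarrow>
      (\<exists>\<epsilon>>0. \<forall>y. relaxed \<epsilon> y \<longrightarrow> omega_mult \<omega> A y = 0)"
    by (simp add: admits_relaxation_def relaxed_def)
  obtain \<delta> where \<delta>: "0 < \<delta>" "\<And>i j. C $ i $ j \<noteq> 0 \<Longrightarrow> \<delta> < \<bar>C $ i $ j\<bar>"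
    using nonzero_entries_bounded_away[of C] by blast
  have solution_iff: "omega_mult \<omega> A y = 0 \<longleftrightarrow> ?cond" if y: "relaxed \<delta> y" for y
  proof -
    define d where "d j = y $ j - x $ j" for j
    have sum_eq: "A $ i $ j + y $ j = C $ i $ j + d j" for i j
      by (simp add: assms(6) d_def)
    have d_cases: "j \<in> Q \<and> j \<notin> R \<and> - \<delta> \<le> d j \<and> d j < 0 \<or>
        j \<in> R \<and> j \<notin> Q \<and> 0 < d j \<and> d j \<le> \<delta> \<or>
        j \<notin> Q \<and> j \<notin> R \<and> d j = 0" for j
    proof -
      consider "j \<in> Q" "j \<notin> R" | "j \<in> R" "j \<notin> Q" | "j \<in> UNIV - (Q \<union> R)"
        using assms(4) by blast
      then show ?thesis
      proof cases
        case 1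
        with y have "x $ j - \<delta> \<le> y $ j \<and> y $ j < x $ j" by (simp only: relaxed_def)
        with 1 show ?thesis by (simp add: d_def)
      next
        case 2
        with y have "x $ j < y $ j \<and> y $ j \<le> x $ j + \<delta>" by (simp only: relaxed_def)
        with 2 show ?thesis by (simp add: d_def)
      next
        case 3
        with y have "y $ j = x $ j" by (simp only: relaxed_def)
        with 3 show ?thesis by (simp add: d_def)
      qed
    qed
    have small: "\<bar>d j\<bar> < \<bar>C $ i $ j\<bar>" if "C $ i $ j \<noteq> 0" for i j
      using d_cases[of j] \<delta>(1) \<delta>(2)[OF that] by linarith
    have dQ: "d j < 0 \<longleftrightarrow> j \<in> Q" and dR: "0 < d j \<longleftrightarrow> j \<in> R" for j
      using d_cases[of j] by auto
    have "card {j. A $ i $ j + y $ j < 0} = num_neg C i + card (Q \<inter> zero_cols C i)" for i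
      using card_neg_perturb[of "\<lambda>j. C $ i $ j" d Q, OF small dQ]
      by (simp add: sum_eq num_neg_def zero_cols_def)
    moreover have "card {j. 0 < A $ i $ j + y $ j} = num_pos C i + card (R \<inter> zero_cols C i)" for i
      using card_pos_perturb[of "\<lambda>j. C $ i $ j" d R, OF small dR]
      by (simp add: sum_eq num_pos_def zero_cols_def)
    ultimately have "omega_mult \<omega> A y = 0 \<longleftrightarrow>
        (\<forall>i. num_neg C i + card (Q \<inter> zero_cols C i) < p \<and>
             p + (num_pos C i + card (R \<inter> zero_cols C i)) \<le> CARD('n))"
      by (simp add: omega_mult_eq_0_iff[OF assms(1-3)])
    also have "\<dots> \<longleftrightarrow> ?cond"
      by (intro iff_allI conj_cong) linarith+
    finally show ?thesis .
  qed
  show ?thesis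
  proof
    assume "admits_relaxation \<omega> A Q R x"
    then obtain \<epsilon> where \<epsilon>: "0 < \<epsilon>" "\<And>y. relaxed \<epsilon> y \<Longrightarrow> omega_mult \<omega> A y = 0"
      unfolding admits by blast
    \<comment> \<open>One extremal step, small enough for \<open>\<epsilon>\<close> as well as for the sign gap \<open>\<delta>\<close>.\<close>
    define y :: "real^'n" where
      "y = (\<chi> j. x $ j + (if j \<in> Q then - min \<epsilon> \<delta> else if j \<in> R then min \<epsilon> \<delta> else 0))"
    have "relaxed \<epsilon> y" and "relaxed \<delta> y"
      using \<epsilon>(1) \<delta>(1) assms(4) by (auto simp: relaxed_def y_def)
    then show ?cond
      using \<epsilon>(2) solution_iff by blast
  next
    assume ?cond
    then show "admits_relaxation \<omega> A Q R x"
      unfolding admits using \<delta>(1) solution_iff by blast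
  qed
qed

end
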